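(* For each integer $\ell\geq 2$, $g(n,C_{2\ell})=\Omega\big(n^{1-\frac{2}{\ell+1}}\big)$ as $n\to\infty$, where $C_{2\ell}$ is the cycle of length $2\ell$. Consequently, for every even $r\geq 4$, $g(n,K_r)=\Omega\big(n^{1-\frac{4}{r+2}}\big)$.
   Context: For a positive integer $n$ and a graph $H$: for each vertex $v$ of the complete graph $K_n$ let $f_v$ be a (not necessarily proper) colouring of the edges of the same $K_n$. The collection $\{f_v\}$ is called $(n,H)$-local if for every copy $T$ of $H$ in $K_n$ (i.e. every subgraph of $K_n$ isomorphic to $H$), there exists a vertex $u\in V(T)$ such that all edges of $T$ receive pairwise different colours in $f_u$. $g(n,H)$ is the smallest $k$ for which there is an $(n,H)$-local collection of colourings each using at most $k$ colours. *)

theory Defs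
  imports Complex_Main "HOL-Library.Landau_Symbols"
begin

(* A finite simple graph is a pair (vertex set, edge set); edges are two-element sets. *)
type_synonym 'a sgraph = "'a set \<times> 'a set set"

abbreviation verts :: "'a sgraph \<Rightarrow> 'a set" where
  "verts G \<equiv> fst G"

abbreviation edges :: "'a sgraph \<Rightarrow> 'a set set" where
  "edges G \<equiv> snd G"

definition simple_graph :: "'a sgraph \<Rightarrow> bool" where
  "simple_graph G \<longleftrightarrow> finite (verts G) \<and> (\<forall>e\<in>edges G. e \<subseteq> verts G \<and> card e = 2)"

definition subgraph :: "'a sgraph \<Rightarrow> 'a sgraph \<Rightarrow> bool" where
  "subgraph T G \<longleftrightarrow> simple_graph T \<and> verts T \<subseteq> verts G \<and> edges T \<subseteq> edges G"

definition graph_iso :: "'a sgraph \<Rightarrow> 'b sgraph \<Rightarrow> bool" where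
  "graph_iso G H \<longleftrightarrow>
     (\<exists>\<phi>. bij_betw \<phi> (verts G) (verts H) \<and> (\<lambda>e. \<phi> ` e) ` edges G = edges H)"

definition complete_graph :: "nat \<Rightarrow> nat sgraph" where
  "complete_graph n = ({..<n}, {e. e \<subseteq> {..<n} \<and> card e = 2})"

(* This is a cycle only for m \<ge> 3. *)
definition cycle_graph :: "nat \<Rightarrow> nat sgraph" where
  "cycle_graph m = ({..<m}, {{i, (i + 1) mod m} | i. i < m})"

(* Copies of H are subgraphs of K_n isomorphic to H, not necessarily induced.
   f v is a colouring of the edges of K_n; its values elsewhere are irrelevant.  Taking colours
   in nat is no restriction since K_n has finitely many edges. *)
definition local_collection :: "nat \<Rightarrow> 'a sgraph \<Rightarrow> (nat \<Rightarrow> nat set \<Rightarrow> nat) \<Rightarrow> bool" where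
  "local_collection n H f \<longleftrightarrow>
     (\<forall>T. subgraph T (complete_graph n) \<and> graph_iso T H \<longrightarrow>
        (\<exists>u\<in>verts T. inj_on (f u) (edges T)))"

definition g :: "nat \<Rightarrow> 'a sgraph \<Rightarrow> nat" where
  "g n H = (LEAST k. \<exists>f. local_collection n H f \<and>
     (\<forall>v\<in>verts (complete_graph n). card (f v ` edges (complete_graph n)) \<le> k))"

(* The minimum in the definition of g is over a nonempty set. *)
lemma g_attained:
  assumes "verts H \<noteq> {}"
  shows "\<exists>f. local_collection n H f \<and>
    (\<forall>v\<in>verts (complete_graph n). card (f v ` edges (complete_graph n)) \<le> g n H)"
proof -
  let ?E = "edges (complete_graph n)"
  have "?E \<subseteq> Pow {..<n}"
    by (auto simp: complete_graph_def)
  then have "finite ?E"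
    by (rule finite_subset) simp
  then obtain h :: "nat set \<Rightarrow> nat" where h: "inj_on h ?E"
    using finite_imp_inj_to_nat_seg by blast
  have "local_collection n H (\<lambda>_. h)"
    unfolding local_collection_def
  proof (intro allI impI, elim conjE)
    fix T assume T: "subgraph T (complete_graph n)" "graph_iso T H"
    have "verts T \<noteq> {}"
      using T(2) assms by (auto simp: graph_iso_def bij_betw_def)
    moreover have "inj_on h (edges T)"
      using h T(1) by (meson inj_on_subset subgraph_def)
    ultimately show "\<exists>u\<in>verts T. inj_on h (edges T)"
      by blast
  qed
  then have "\<exists>k f. local_collection n H f \<and>
      (\<forall>v\<in>verts (complete_graph n). card (f v ` ?E) \<le> k)"
    by (intro exI[of _ "card (h ` ?E)"] exI[of _ "\<lambda>_. h"]) simp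
  then show ?thesis
    unfolding g_def by (rule LeastI_ex)
qed

end

theory Submission
  imports Defs "HOL-Analysis.Convex"
begin

text \<open>Split every vertex v of the complete graph into copies (v, i), one for each colour i of f v, and
  let the edge vw join (v, f v vw) to (w, f w vw).  A 2l-cycle in this split graph whose first
  coordinates are distinct is a 2l-cycle in which every vertex sees its two incident edges in the
  same colour, so locality forbids it.  The split graph has at most nk vertices and average degree
  about n/k, hence a subgraph of minimum degree m of order n/k.

  Let K be the degree-normalised adjacency matrix of that subgraph and H j the trace of the 2j-th
  power of K, so H l is the weighted number of closed 2l-walks.  Every such walk repeats a first
  coordinate at some pair of positions.  Since a vertex has at most one neighbour over each v,
  cutting the walk at two antipodal points that separate the pair, one of them next to a member of
  the pair, and applying the Cauchy-Schwarz inequality bounds the walks with a given bad pair by the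
  square root of H (l - 1) * H l / m.  So H l is at most a constant times H (l - 1) / m, and by
  log-convexity of H at most nk times the l-th power of a constant over m.  Because 1 is an
  eigenvalue of K, H l is at least 1, whence m ^ l = O(nk).\<close>

section \<open>Weights of walks\<close>

lemma sum_squares_le_square_sum:
  fixes p :: "'a \<Rightarrow> real"
  assumes "\<And>i. i \<in> I \<Longrightarrow> 0 \<le> p i"
  shows "(\<Sum>i\<in>I. (p i)\<^sup>2) \<le> (\<Sum>i\<in>I. p i)\<^sup>2"
proof (cases "finite I")
  case True
  have "(\<Sum>i\<in>I. (p i)\<^sup>2) = (\<Sum>i\<in>I. p i * p i)"
    by (simp add: power2_eq_square)
  also have "\<dots> \<le> (\<Sum>i\<in>I. p i * (\<Sum>j\<in>I. p j))"
    using True assms by (intro sum_mono mult_left_mono member_le_sum) auto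
  also have "\<dots> = (\<Sum>i\<in>I. p i)\<^sup>2"
    by (simp add: power2_eq_square sum_distrib_right)
  finally show ?thesis .
qed simp

fun kpow :: "'a set \<Rightarrow> ('a \<Rightarrow> 'a \<Rightarrow> real) \<Rightarrow> nat \<Rightarrow> 'a \<Rightarrow> 'a \<Rightarrow> real" where
  "kpow V K 0 x y = of_bool (x = y)"
| "kpow V K (Suc m) x y = (\<Sum>z\<in>V. K x z * kpow V K m z y)"

text \<open>The list holds only the interior vertices, so a list of length m stands for a walk of m
  + 1 steps. In \<open>cycle_weight\<close> the head is the base point, and a nonempty list of
  length m gives m steps.\<close>

fun path_weight :: "('a \<Rightarrow> 'a \<Rightarrow> real) \<Rightarrow> 'a \<Rightarrow> 'a list \<Rightarrow> 'a \<Rightarrow> real" where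
  "path_weight K a [] b = K a b"
| "path_weight K a (x # xs) b = K a x * path_weight K x xs b"

definition cycle_weight :: "('a \<Rightarrow> 'a \<Rightarrow> real) \<Rightarrow> 'a list \<Rightarrow> real" where
  "cycle_weight K xs = path_weight K (hd xs) (tl xs) (hd xs)"

abbreviation nlists :: "'a set \<Rightarrow> nat \<Rightarrow> 'a list set" where
  "nlists V m \<equiv> {xs. set xs \<subseteq> V \<and> length xs = m}"

lemma path_weight_append:
  "path_weight K a (xs @ y # ys) b = path_weight K a xs y * path_weight K y ys b"
  by (induction xs arbitrary: a) auto

text \<open>Cutting a closed walk at y and z leaves two arcs. The one from z back to y passes the
  base point, hence runs through \<open>cs\<close> and then \<open>as\<close>.\<close>

lemma cycle_weight_split:
  "cycle_weight K (as @ y # bs @ z # cs) = path_weight K y bs z * path_weight K z (cs @ as) y"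
  by (cases as) (simp_all add: cycle_weight_def path_weight_append)

lemma path_weight_nonzero_step:
  assumes "path_weight K a xs b \<noteq> 0" "i \<le> length xs"
  shows "K ((a # xs @ [b]) ! i) ((a # xs @ [b]) ! Suc i) \<noteq> 0"
  using assms
proof (induction xs arbitrary: a i)
  case (Cons x xs)
  then show ?case by (cases i) auto
qed auto

lemma cycle_weight_nonzero_step:
  assumes "cycle_weight K xs \<noteq> 0" "i < length xs"
  shows "K (xs ! i) (xs ! ((i + 1) mod length xs)) \<noteq> 0"
proof -
  obtain a ys where xs: "xs = a # ys"
    using assms(2) by (cases xs) auto
  have "K ((a # ys @ [a]) ! i) ((a # ys @ [a]) ! Suc i) \<noteq> 0"
    by (rule path_weight_nonzero_step) (use assms in \<open>simp_all add: xs cycle_weight_def\<close>)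
  moreover have "(a # ys @ [a]) ! i = xs ! i"
    using assms(2) by (auto simp: xs nth_append nth_Cons split: nat.split)
  moreover have "(a # ys @ [a]) ! Suc i = xs ! ((i + 1) mod length xs)"
    using assms(2) by (cases "i = length ys") (auto simp: xs nth_append)
  ultimately show ?thesis by simp
qed

lemma nlists_Suc: "nlists V (Suc m) = (\<lambda>(x, xs). x # xs) ` (V \<times> nlists V m)"
  by (auto simp: image_iff length_Suc_conv)

lemma sum_nlists_Suc: "(\<Sum>xs\<in>nlists V (Suc m). F xs) = (\<Sum>x\<in>V. \<Sum>xs\<in>nlists V m. F (x # xs))"
  unfolding nlists_Suc sum.cartesian_product
  by (subst sum.reindex) (auto simp: inj_on_def case_prod_unfold)

lemma sum_nlists_add:
  "(\<Sum>xs\<in>nlists V (p + q). F xs) = (\<Sum>xs\<in>nlists V p. \<Sum>ys\<in>nlists V q. F (xs @ ys))"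
proof (induction p arbitrary: F)
  case 0
  have "nlists V 0 = {[]}" by auto
  then show ?case by simp
next
  case (Suc p)
  then show ?case by (simp only: add_Suc sum_nlists_Suc append_Cons)
qed

section \<open>Powers of a symmetric nonnegative kernel and their traces\<close>

locale kernel =
  fixes V :: "'a set" and K :: "'a \<Rightarrow> 'a \<Rightarrow> real"
  assumes finite_V: "finite V"
    and K_sym: "\<And>x y. K x y = K y x"
    and K_nonneg: "\<And>x y. 0 \<le> K x y"
begin

abbreviation P :: "nat \<Rightarrow> 'a \<Rightarrow> 'a \<Rightarrow> real" where
  "P \<equiv> kpow V K"

text \<open>Squared Frobenius norm of the m-th power, which by symmetry is the trace of the 2m-th
  power. The form as a sum of squares suits Cauchy-Schwarz.\<close>

definition H :: "nat \<Rightarrow> real" where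
  "H m = (\<Sum>x\<in>V. \<Sum>y\<in>V. (P m x y)\<^sup>2)"

lemma P_nonneg: "0 \<le> P m x y"
  by (induction m arbitrary: x) (auto intro!: sum_nonneg mult_nonneg_nonneg K_nonneg)

lemma H_nonneg: "0 \<le> H m"
  unfolding H_def by (intro sum_nonneg) auto

lemma P_add:
  assumes "x \<in> V"
  shows "P (m + k) x y = (\<Sum>z\<in>V. P m x z * P k z y)"
  using assms
proof (induction m arbitrary: x)
  case 0
  then show ?case by (simp add: finite_V)
next
  case (Suc m)
  have "P (Suc m + k) x y = (\<Sum>u\<in>V. K x u * (\<Sum>z\<in>V. P m u z * P k z y))"
    using Suc by simp
  also have "\<dots> = (\<Sum>z\<in>V. \<Sum>u\<in>V. K x u * P m u z * P k z y)"
    by (subst sum.swap) (simp add: sum_distrib_left mult.assoc)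
  finally show ?case
    by (simp add: sum_distrib_right)
qed

lemma P_1:
  assumes "y \<in> V"
  shows "P (Suc 0) x y = K x y"
  using assms by (simp add: finite_V)

lemma P_Suc_right:
  assumes "x \<in> V" "y \<in> V"
  shows "P (Suc m) x y = (\<Sum>z\<in>V. P m x z * K z y)"
  using P_add[OF assms(1), of m "Suc 0" y] assms(2) by (simp add: P_1 del: kpow.simps)

lemma P_sym:
  assumes "x \<in> V" "y \<in> V"
  shows "P m x y = P m y x"
  using assms
proof (induction m arbitrary: x y)
  case (Suc m)
  have "P (Suc m) x y = (\<Sum>z\<in>V. P m x z * K z y)"
    by (rule P_Suc_right) fact+
  also have "\<dots> = P (Suc m) y x"
    using Suc by (auto intro!: sum.cong simp: K_sym[of y] mult.commute)
  finally show ?case .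
qed auto

lemma H_eq_trace: "H m = (\<Sum>x\<in>V. P (m + m) x x)"
  unfolding H_def
proof (intro sum.cong refl)
  fix x assume x: "x \<in> V"
  show "(\<Sum>y\<in>V. (P m x y)\<^sup>2) = P (m + m) x x"
    unfolding P_add[OF x] using P_sym[OF x] by (simp add: power2_eq_square)
qed

text \<open>The trace of the power 2m + 2 is split as m plus m + 2, and Cauchy-Schwarz is applied to
  the two factors.\<close>

lemma H_log_convex: "(H (Suc m))\<^sup>2 \<le> H m * H (Suc (Suc m))"
proof -
  have "H (Suc m) = (\<Sum>x\<in>V. P (m + Suc (Suc m)) x x)"
    unfolding H_eq_trace by simp
  also have "\<dots> = (\<Sum>x\<in>V. \<Sum>y\<in>V. P m x y * P (Suc (Suc m)) x y)"
  proof (intro sum.cong refl)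
    fix x assume x: "x \<in> V"
    show "P (m + Suc (Suc m)) x x = (\<Sum>y\<in>V. P m x y * P (Suc (Suc m)) x y)"
      unfolding P_add[OF x] using P_sym[OF _ x] by (intro sum.cong refl) (simp del: kpow.simps)
  qed
  also have "\<dots> = (\<Sum>(x, y)\<in>V \<times> V. P m x y * P (Suc (Suc m)) x y)"
    by (rule sum.cartesian_product)
  finally have "(H (Suc m))\<^sup>2 \<le> (\<Sum>(x, y)\<in>V \<times> V. (P m x y)\<^sup>2) * (\<Sum>(x, y)\<in>V \<times> V. (P (Suc (Suc m)) x y)\<^sup>2)"
    using Cauchy_Schwarz_ineq_sum[of "\<lambda>(x, y). P m x y" "\<lambda>(x, y). P (Suc (Suc m)) x y" "V \<times> V"]
    by (simp only: case_prod_unfold)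
  then show ?thesis
    unfolding H_def sum.cartesian_product .
qed

text \<open>By log-convexity the ratios of consecutive values of \<open>H\<close>, where defined, do
  not decrease. A bound C on the last ratio thus passes to all earlier ones.\<close>

lemma H_ratio_descend:
  assumes "H (Suc m) \<le> C * H m" "C \<ge> 0"
  shows "H (Suc m) \<le> C ^ Suc m * H 0"
  using assms(1)
proof (induction m)
  case (Suc m)
  have "H (Suc m) \<le> C * H m"
  proof (cases "H (Suc m) = 0")
    case True
    then show ?thesis using assms(2) H_nonneg[of m] by simp
  next
    case False
    then have pos: "H (Suc m) > 0" using H_nonneg[of "Suc m"] by simp
    have "H (Suc m) * H (Suc m) \<le> H m * H (Suc (Suc m))"
      using H_log_convex[of m] by (simp add: power2_eq_square)
    also have "\<dots> \<le> H m * (C * H (Suc m))"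
      using Suc.prems H_nonneg[of m] by (rule mult_left_mono)
    finally have "H (Suc m) * H (Suc m) \<le> (C * H m) * H (Suc m)"
      by (simp add: ac_simps)
    then show ?thesis using pos by simp
  qed
  from Suc.IH[OF this] have "C * H (Suc m) \<le> C * (C ^ Suc m * H 0)"
    using assms(2) by (rule mult_left_mono)
  then show ?case using Suc.prems by simp
qed auto

lemma H_0: "H 0 = card V"
proof -
  have "(P 0 x y)\<^sup>2 = of_bool (x = y)" for x y by simp
  then show ?thesis unfolding H_def by (simp add: finite_V)
qed

section \<open>Lower bound on traces from a fixed vector\<close>

lemma P_eigenvector:
  assumes "\<And>x. x \<in> V \<Longrightarrow> (\<Sum>y\<in>V. K x y * \<phi> y) = \<phi> x" "x \<in> V"
  shows "(\<Sum>y\<in>V. P m x y * \<phi> y) = \<phi> x"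
  using assms(2)
proof (induction m arbitrary: x)
  case 0
  then show ?case by (simp add: finite_V)
next
  case (Suc m)
  have "(\<Sum>y\<in>V. P (Suc m) x y * \<phi> y) = (\<Sum>z\<in>V. K x z * (\<Sum>y\<in>V. P m z y * \<phi> y))"
    unfolding kpow.simps sum_distrib_left sum_distrib_right
    by (subst sum.swap) (simp add: mult.assoc)
  also have "\<dots> = \<phi> x"
    using Suc assms(1) by simp
  finally show ?case .
qed

text \<open>The squared norm of \<phi> equals the entrywise inner product of the m-th power with the
  rank-one matrix of entries \<open>\<phi> x * \<phi> y\<close>. The Frobenius norm of that matrix
  is again the squared norm of \<phi>, so Cauchy-Schwarz leaves the bound.\<close>

lemma H_ge_1:
  assumes "\<And>x. x \<in> V \<Longrightarrow> (\<Sum>y\<in>V. K x y * \<phi> y) = \<phi> x" "0 < (\<Sum>x\<in>V. (\<phi> x)\<^sup>2)"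
  shows "1 \<le> H m"
proof -
  let ?D = "\<Sum>x\<in>V. (\<phi> x)\<^sup>2"
  have "?D = (\<Sum>x\<in>V. \<phi> x * (\<Sum>y\<in>V. P m x y * \<phi> y))"
    using P_eigenvector[OF assms(1)] by (simp add: power2_eq_square)
  also have "\<dots> = (\<Sum>t\<in>V \<times> V. (case t of (x, y) \<Rightarrow> P m x y) * (case t of (x, y) \<Rightarrow> \<phi> x * \<phi> y))"
    by (simp add: sum_distrib_left sum.cartesian_product case_prod_unfold ac_simps)
  finally have "?D\<^sup>2 \<le> (\<Sum>t\<in>V \<times> V. (case t of (x, y) \<Rightarrow> P m x y)\<^sup>2) *
      (\<Sum>t\<in>V \<times> V. (case t of (x, y) \<Rightarrow> \<phi> x * \<phi> y)\<^sup>2)"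
    using Cauchy_Schwarz_ineq_sum by simp
  also have "(\<Sum>t\<in>V \<times> V. (case t of (x, y) \<Rightarrow> P m x y)\<^sup>2) = H m"
    by (simp add: H_def sum.cartesian_product case_prod_unfold)
  also have "(\<Sum>t\<in>V \<times> V. (case t of (x, y) \<Rightarrow> \<phi> x * \<phi> y)\<^sup>2) = ?D\<^sup>2"
    by (simp add: power2_eq_square[of ?D] sum_product sum.cartesian_product case_prod_unfold power_mult_distrib)
  finally show ?thesis using assms(2) by simp
qed

section \<open>Powers and traces as sums over walks\<close>

lemma sum_path_weight:
  assumes "b \<in> V"
  shows "(\<Sum>xs\<in>nlists V m. path_weight K a xs b) = P (Suc m) a b"
proof (induction m arbitrary: a)
  case 0
  have "nlists V 0 = {[]}" by auto
  then show ?case using P_1[OF assms] by simp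
next
  case (Suc m)
  show ?case
    unfolding sum_nlists_Suc path_weight.simps sum_distrib_left[symmetric] Suc.IH by simp
qed

lemma path_weight_nonneg: "0 \<le> path_weight K a xs b"
  by (induction xs arbitrary: a) (auto intro: K_nonneg mult_nonneg_nonneg)

lemma sum_cycle_weight: "(\<Sum>xs\<in>nlists V (Suc m). cycle_weight K xs) = (\<Sum>x\<in>V. P (Suc m) x x)"
  unfolding sum_nlists_Suc cycle_weight_def by (simp add: sum_path_weight del: kpow.simps)

lemma finite_nlists: "finite (nlists V m)"
  using finite_lists_length_eq[OF finite_V] .

end

section \<open>Closed walks with a repeated class\<close>

text \<open>In the application \<open>c\<close> is the first coordinate of a split vertex and
  \<delta> is the reciprocal of a lower bound on the degrees.\<close>

locale conflict_kernel = kernel V K for V :: "'a set" and K :: "'a \<Rightarrow> 'a \<Rightarrow> real" +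
  fixes c :: "'a \<Rightarrow> 'b" and \<delta> :: real
  assumes nbr_unique: "\<And>x y z. K x y \<noteq> 0 \<Longrightarrow> K x z \<noteq> 0 \<Longrightarrow> c y = c z \<Longrightarrow> y = z"
    and col_square: "\<And>w. w \<in> V \<Longrightarrow> (\<Sum>a\<in>V. (K a w)\<^sup>2) \<le> \<delta>"
begin

text \<open>Total weight of closed walks of j + k steps marked at two vertices y and z of equal
  class, j steps apart. The case y = z is included, so a repeated vertex is a conflict too.\<close>

definition B :: "nat \<Rightarrow> nat \<Rightarrow> real" where
  "B j k = (\<Sum>y\<in>V. \<Sum>z\<in>{z \<in> V. c y = c z}. P j y z * P k z y)"

lemma B_commute: "B j k = B k j"
proof -
  have "B j k = (\<Sum>z\<in>V. \<Sum>y\<in>{y \<in> V. c y = c z}. P j y z * P k z y)"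
    unfolding B_def using finite_V by (rule sum.swap_restrict) (rule finite_V)
  also have "\<dots> = B k j"
    unfolding B_def by (intro sum.cong) (auto simp: mult.commute)
  finally show ?thesis .
qed

text \<open>Given a, the class of z contains at most one neighbour w of a. Summing \<open>R\<close>
  over w therefore counts each walk from a through z to b at most once, and a sum of squares of
  nonnegative terms is at most the square of their sum.\<close>

lemma conflict_square_bound:
  fixes i k :: nat
  assumes "a \<in> V" "b \<in> V"
  defines "R \<equiv> \<lambda>w. if K a w = 0 then 0 else \<Sum>z\<in>{z \<in> V. c w = c z}. P i a z * P k z b"
  shows "(\<Sum>w\<in>V. (R w)\<^sup>2) \<le> (P (i + k) a b)\<^sup>2"
proof -
  let ?p = "\<lambda>z. P i a z * P k z b"
  have p: "0 \<le> ?p z" for z by (simp add: P_nonneg)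
  have R0: "0 \<le> R w" for w unfolding R_def using p by (auto intro: sum_nonneg)
  let ?W = "{w \<in> V. K a w \<noteq> 0}"
  have "(\<Sum>w\<in>V. R w) = (\<Sum>w\<in>?W. \<Sum>z\<in>{z \<in> V. c w = c z}. ?p z)"
    unfolding R_def using finite_V by (intro sum.mono_neutral_cong_right) auto
  also have "\<dots> = (\<Sum>z\<in>V. \<Sum>w\<in>{w \<in> ?W. c w = c z}. ?p z)"
    using finite_V by (intro sum.swap_restrict) auto
  also have "\<dots> \<le> (\<Sum>z\<in>V. ?p z)"
  proof (rule sum_mono)
    fix z
    have "card {w \<in> ?W. c w = c z} \<le> 1"
      using nbr_unique finite_V by (auto simp: card_le_Suc0_iff_eq)
    then have "real (card {w \<in> ?W. c w = c z}) * ?p z \<le> 1 * ?p z"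
      using p by (intro mult_right_mono) auto
    then show "(\<Sum>w\<in>{w \<in> ?W. c w = c z}. ?p z) \<le> ?p z" by simp
  qed
  also have "\<dots> = P (i + k) a b"
    using assms by (simp add: P_add)
  finally have "(\<Sum>w\<in>V. R w) \<le> P (i + k) a b" .
  then have "(\<Sum>w\<in>V. R w)\<^sup>2 \<le> (P (i + k) a b)\<^sup>2"
    using R0 by (intro power_mono sum_nonneg) auto
  moreover have "(\<Sum>w\<in>V. (R w)\<^sup>2) \<le> (\<Sum>w\<in>V. R w)\<^sup>2"
    using R0 by (intro sum_squares_le_square_sum) auto
  ultimately show ?thesis by linarith
qed

text \<open>In a closed walk of length 2(m + 1), w and z are the conflicting vertices, a is the
  successor of w on the side of z, and b is antipodal to a.  The vertex w is a neighbour of a, so z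
  determines it.\<close>

lemma B_bound_aux:
  assumes "i \<le> Suc m"
  shows "(B (Suc i) (Suc m - i + m))\<^sup>2 \<le> \<delta> * H m * H (Suc m)"
proof -
  define k where "k = Suc m - i"
  \<comment> \<open>\<open>q\<close> gathers the factors free of z: the step from a to w and the m
    steps from w to b. \<open>R\<close> gathers the walks of m + 1 steps from a through z to b.
    Setting \<open>R\<close> to 0 where \<open>K a w = 0\<close> changes no product, since
    \<open>q\<close> vanishes there, and makes \<open>conflict_square_bound\<close>
    applicable.\<close>
  define q where "q = (\<lambda>(a, b, w). K a w * P m w b)"
  define R where "R = (\<lambda>(a, b, w). if K a w = 0 then 0
    else \<Sum>z\<in>{z \<in> V. c w = c z}. P i a z * P k z b)"
  have ik: "i + k = Suc m" using assms by (simp add: k_def)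
  have "B (Suc i) (k + m) = (\<Sum>w\<in>V. \<Sum>z\<in>{z \<in> V. c w = c z}.
      (\<Sum>a\<in>V. K w a * P i a z) * (\<Sum>b\<in>V. P k z b * P m b w))"
    unfolding B_def by (intro sum.cong refl) (simp add: P_add)
  also have "\<dots> = (\<Sum>w\<in>V. \<Sum>z\<in>{z \<in> V. c w = c z}. \<Sum>a\<in>V. \<Sum>b\<in>V.
      K a w * P m w b * (P i a z * P k z b))"
    unfolding sum_product using P_sym K_sym by (intro sum.cong refl) auto
  also have "\<dots> = (\<Sum>w\<in>V. \<Sum>a\<in>V. \<Sum>b\<in>V. \<Sum>z\<in>{z \<in> V. c w = c z}.
      K a w * P m w b * (P i a z * P k z b))"
    by (subst sum.swap, subst (2) sum.swap, rule refl)
  also have "\<dots> = (\<Sum>w\<in>V. \<Sum>a\<in>V. \<Sum>b\<in>V. q (a, b, w) * R (a, b, w))"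
    by (intro sum.cong refl) (auto simp: q_def R_def sum_distrib_left)
  also have "\<dots> = (\<Sum>a\<in>V. \<Sum>b\<in>V. \<Sum>w\<in>V. q (a, b, w) * R (a, b, w))"
    by (subst sum.swap, subst (2) sum.swap, rule refl)
  also have "\<dots> = (\<Sum>t\<in>V \<times> V \<times> V. q t * R t)"
    by (simp add: sum.cartesian_product case_prod_unfold)
  finally have "(B (Suc i) (k + m))\<^sup>2 \<le> (\<Sum>t\<in>V \<times> V \<times> V. (q t)\<^sup>2) * (\<Sum>t\<in>V \<times> V \<times> V. (R t)\<^sup>2)"
    using Cauchy_Schwarz_ineq_sum by simp
  moreover have "(\<Sum>t\<in>V \<times> V \<times> V. (q t)\<^sup>2) \<le> \<delta> * H m"
  proof -
    have "(\<Sum>t\<in>V \<times> V \<times> V. (q t)\<^sup>2) = (\<Sum>a\<in>V. \<Sum>b\<in>V. \<Sum>w\<in>V. (K a w)\<^sup>2 * (P m w b)\<^sup>2)"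
      by (simp add: sum.cartesian_product case_prod_unfold q_def power_mult_distrib)
    also have "\<dots> = (\<Sum>w\<in>V. \<Sum>a\<in>V. \<Sum>b\<in>V. (K a w)\<^sup>2 * (P m w b)\<^sup>2)"
      by (subst (2) sum.swap, subst sum.swap, rule refl)
    also have "\<dots> = (\<Sum>w\<in>V. (\<Sum>a\<in>V. (K a w)\<^sup>2) * (\<Sum>b\<in>V. (P m w b)\<^sup>2))"
      by (simp add: sum_product)
    also have "\<dots> \<le> (\<Sum>w\<in>V. \<delta> * (\<Sum>b\<in>V. (P m w b)\<^sup>2))"
      by (intro sum_mono mult_right_mono col_square sum_nonneg) auto
    also have "\<dots> = \<delta> * H m"
      by (simp add: H_def sum_distrib_left)
    finally show ?thesis .
  qed
  moreover have "(\<Sum>t\<in>V \<times> V \<times> V. (R t)\<^sup>2) \<le> H (Suc m)"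
  proof -
    have "(\<Sum>t\<in>V \<times> V \<times> V. (R t)\<^sup>2) = (\<Sum>a\<in>V. \<Sum>b\<in>V. \<Sum>w\<in>V. (R (a, b, w))\<^sup>2)"
      by (simp add: sum.cartesian_product case_prod_unfold)
    also have "\<dots> \<le> (\<Sum>a\<in>V. \<Sum>b\<in>V. (P (i + k) a b)\<^sup>2)"
      unfolding R_def prod.case by (intro sum_mono conflict_square_bound)
    finally show ?thesis by (simp only: H_def ik)
  qed
  ultimately have "(B (Suc i) (k + m))\<^sup>2 \<le> \<delta> * H m * H (Suc m)"
    by (meson mult_mono order_trans sum_nonneg zero_le_power2)
  then show ?thesis by (simp only: k_def)
qed

text \<open>By \<open>B_commute\<close> the arc of j steps may be taken as the shorter one, so that
  z is met on the way from a to its antipode b.\<close>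

lemma B_bound:
  assumes "0 < j" "0 < k" "j + k = 2 * Suc m"
  shows "(B j k)\<^sup>2 \<le> \<delta> * H m * H (Suc m)"
proof -
  have *: "(B j k)\<^sup>2 \<le> \<delta> * H m * H (Suc m)" if "0 < j" "j \<le> k" "j + k = 2 * Suc m" for j k
  proof -
    obtain i where i: "j = Suc i" using gr0_implies_Suc[OF \<open>0 < j\<close>] by blast
    have "k = Suc m - i + m" "i \<le> Suc m" using that by (auto simp: i)
    then show ?thesis using B_bound_aux[of i m] by (simp only: i)
  qed
  show ?thesis
    using *[of j k] *[of k j] assms by (cases "j \<le> k") (auto simp: B_commute)
qed

text \<open>Only walks with a repeated class contribute to the trace. They are covered by the pairs
  of conflicting positions, each of which contributes a value of \<open>B\<close>.\<close>

lemma trace_bound_of_no_rainbow_cycle: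
  assumes "\<And>xs. xs \<in> nlists V (2 * Suc m) \<Longrightarrow> distinct (map c xs) \<Longrightarrow> cycle_weight K xs = 0"
  shows "H (Suc m) \<le> (real (2 * Suc m)) ^ 2 * sqrt (\<delta> * H m * H (Suc m))"
proof -
  let ?L = "2 * Suc m"
  let ?I = "{(p, q). p + q + 2 \<le> ?L}"
  \<comment> \<open>p entries precede y and q entries lie between y and z; the rest of the list
    follows z.\<close>
  define S where "S = (\<lambda>(p, q). {(as, cs, y, z, bs). as \<in> nlists V p \<and> cs \<in> nlists V (?L - 2 - p - q)
     \<and> y \<in> V \<and> z \<in> {z \<in> V. c y = c z} \<and> bs \<in> nlists V q})"
  define join where "join = (\<lambda>(as, cs, y :: 'a, z, bs). as @ y # bs @ z # cs)"
  define bad where "bad = {xs \<in> nlists V ?L. \<not> distinct (map c xs)}"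
  have I: "?I \<subseteq> {..<?L} \<times> {..<?L}" by auto
  then have finI: "finite ?I" by (rule finite_subset) auto
  have S_eq: "S (p, q) = nlists V p \<times> nlists V (?L - 2 - p - q) \<times>
      (SIGMA y:V. {z \<in> V. c y = c z} \<times> nlists V q)" for p q
    by (auto simp: S_def)
  have finS: "finite (S pq)" for pq
    by (cases pq) (auto simp: S_eq finite_nlists finite_V intro!: finite_cartesian_product finite_SigmaI)
  have cyc0: "0 \<le> cycle_weight K xs" for xs
    by (simp add: cycle_weight_def path_weight_nonneg)
  have bad_sub: "bad \<subseteq> (\<lambda>(pq, t). join t) ` Sigma ?I S"
  proof
    fix xs assume "xs \<in> bad"
    then have xs: "set xs \<subseteq> V" "length xs = ?L" "\<not> distinct (map c xs)"
      by (auto simp: bad_def)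
    obtain as' y' bs' cs' where "map c xs = as' @ [y'] @ bs' @ [y'] @ cs'"
      using not_distinct_decomp[OF xs(3)] by blast
    then have "\<exists>as y bs z cs. xs = as @ y # bs @ z # cs \<and> c y = c z"
      by (simp add: map_eq_append_conv append_eq_map_conv map_eq_Cons_conv Cons_eq_map_conv) metis
    then obtain as y bs z cs where d: "xs = as @ y # bs @ z # cs" "c y = c z"
      by blast
    have "(as, cs, y, z, bs) \<in> S (length as, length bs)" "(length as, length bs) \<in> ?I"
      using xs d by (auto simp: S_def)
    moreover have "xs = join (as, cs, y, z, bs)" by (simp add: join_def d)
    ultimately show "xs \<in> (\<lambda>(pq, t). join t) ` Sigma ?I S" by force
  qed
  have part: "(\<Sum>t\<in>S pq. cycle_weight K (join t)) \<le> sqrt (\<delta> * H m * H (Suc m))"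
    if "pq \<in> ?I" for pq
  proof -
    obtain p q where pq: "pq = (p, q)" by (cases pq)
    define r where "r = ?L - 2 - p - q"
    have r: "p + q + 2 + r = ?L" using that by (simp add: pq r_def)
    have "(\<Sum>t\<in>S pq. cycle_weight K (join t)) = (\<Sum>as\<in>nlists V p. \<Sum>cs\<in>nlists V r. \<Sum>y\<in>V.
        \<Sum>z\<in>{z \<in> V. c y = c z}. \<Sum>bs\<in>nlists V q. path_weight K y bs z * path_weight K z (cs @ as) y)"
      unfolding pq S_eq r_def[symmetric] join_def
      by (simp add: sum.cartesian_product sum.Sigma finite_V finite_nlists cycle_weight_split case_prod_unfold)
    \<comment> \<open>The swap puts \<open>cs\<close> before \<open>as\<close>, the order in which
      the arc from z back to y meets them, so that the two sums merge into one.\<close>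
    also have "\<dots> = (\<Sum>cs\<in>nlists V r. \<Sum>as\<in>nlists V p. \<Sum>y\<in>V.
        \<Sum>z\<in>{z \<in> V. c y = c z}. \<Sum>bs\<in>nlists V q. path_weight K y bs z * path_weight K z (cs @ as) y)"
      by (rule sum.swap)
    also have "\<dots> = (\<Sum>xs\<in>nlists V (r + p). \<Sum>y\<in>V.
        \<Sum>z\<in>{z \<in> V. c y = c z}. \<Sum>bs\<in>nlists V q. path_weight K y bs z * path_weight K z xs y)"
      by (subst sum_nlists_add) (rule refl)
    also have "\<dots> = (\<Sum>y\<in>V. \<Sum>z\<in>{z \<in> V. c y = c z}. \<Sum>xs\<in>nlists V (r + p).
        \<Sum>bs\<in>nlists V q. path_weight K y bs z * path_weight K z xs y)"
      by (subst sum.swap, subst (2) sum.swap, rule refl)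
    also have "\<dots> = (\<Sum>y\<in>V. \<Sum>z\<in>{z \<in> V. c y = c z}. (\<Sum>bs\<in>nlists V q. path_weight K y bs z) *
        (\<Sum>xs\<in>nlists V (r + p). path_weight K z xs y))"
      unfolding sum_product by (subst (3) sum.swap) (rule refl)
    also have "\<dots> = B (Suc q) (Suc (r + p))"
      unfolding B_def by (intro sum.cong refl) (simp add: sum_path_weight del: kpow.simps)
    also have "\<dots> \<le> sqrt (\<delta> * H m * H (Suc m))"
      using r by (intro real_le_rsqrt B_bound) auto
    finally show ?thesis .
  qed
  \<comment> \<open>The radicand is nonnegative because it bounds the square of a value of
    \<open>B\<close>.\<close>
  have sq0: "0 \<le> sqrt (\<delta> * H m * H (Suc m))"
    using B_bound[of 1 "?L - 1" m] by (simp add: order_trans[OF zero_le_power2])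
  have "H (Suc m) = (\<Sum>xs\<in>nlists V ?L. cycle_weight K xs)"
    using sum_cycle_weight[of "Suc (2 * m)"] by (simp add: H_eq_trace mult_2 del: kpow.simps)
  also have "\<dots> = (\<Sum>xs\<in>bad. cycle_weight K xs)"
    using assms finite_nlists by (intro sum.mono_neutral_right) (auto simp: bad_def)
  also have "\<dots> \<le> (\<Sum>xs\<in>(\<lambda>(pq, t). join t) ` Sigma ?I S. cycle_weight K xs)"
    using bad_sub finI finS cyc0 by (intro sum_mono2) auto
  \<comment> \<open>A walk with several conflicting pairs is counted once for each, which is
    harmless as weights are nonnegative.\<close>
  also have "\<dots> \<le> (\<Sum>u\<in>Sigma ?I S. cycle_weight K (join (snd u)))"
    using finI finS cyc0 by (intro order_trans[OF sum_image_le]) (auto simp: case_prod_unfold)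
  also have "\<dots> = (\<Sum>pq\<in>?I. \<Sum>t\<in>S pq. cycle_weight K (join t))"
    using finI finS by (subst sum.Sigma) (auto simp: case_prod_unfold)
  also have "\<dots> \<le> (\<Sum>pq\<in>?I. sqrt (\<delta> * H m * H (Suc m)))"
    by (rule sum_mono) (rule part)
  also have "\<dots> = real (card ?I) * sqrt (\<delta> * H m * H (Suc m))"
    by simp
  also have "\<dots> \<le> (real ?L)\<^sup>2 * sqrt (\<delta> * H m * H (Suc m))"
  proof (rule mult_right_mono[OF _ sq0])
    have "card ?I \<le> card ({..<?L} \<times> {..<?L})"
      using I by (intro card_mono) auto
    then show "real (card ?I) \<le> (real ?L)\<^sup>2"
      by (simp add: power2_eq_square flip: of_nat_mult del: mult_Suc mult_Suc_right)
  qed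
  finally show ?thesis .
qed

text \<open>Squaring the trace bound and cancelling one factor \<open>H (Suc m)\<close> bounds the
  last ratio of \<open>H\<close> by \<open>?C\<close>; the ratios then descend to
  \<open>H 0 = card V\<close>.\<close>

lemma H_bound_of_no_rainbow_cycle:
  assumes "\<And>xs. xs \<in> nlists V (2 * Suc m) \<Longrightarrow> distinct (map c xs) \<Longrightarrow> cycle_weight K xs = 0"
    and "0 \<le> \<delta>"
  shows "H (Suc m) \<le> ((real (2 * Suc m)) ^ 4 * \<delta>) ^ Suc m * card V"
proof -
  let ?C = "(real (2 * Suc m)) ^ 4 * \<delta>"
  have C: "0 \<le> ?C" using assms(2) by simp
  have "H (Suc m) \<le> ?C * H m"
  proof (cases "H (Suc m) = 0")
    case True
    then show ?thesis using C H_nonneg[of m] by simp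
  next
    case False
    then have pos: "H (Suc m) > 0" using H_nonneg[of "Suc m"] by simp
    have "(H (Suc m))\<^sup>2 \<le> ((real (2 * Suc m)) ^ 2 * sqrt (\<delta> * H m * H (Suc m)))\<^sup>2"
      using trace_bound_of_no_rainbow_cycle[OF assms(1)] H_nonneg by (intro power_mono) auto
    also have "\<dots> = (?C * H m) * H (Suc m)"
      using assms(2) H_nonneg by (simp add: power_mult_distrib flip: power_mult)
    finally show ?thesis using pos by (simp add: power2_eq_square)
  qed
  then show ?thesis
    using H_ratio_descend[OF _ C] by (simp add: H_0)
qed

end

section \<open>Minimum degree and rainbow even cycles\<close>

text \<open>A subset W maximising the number of ordered adjacent pairs minus
  \<open>2 * m * card W\<close> works: removing a vertex of degree below m would increase this
  quantity. The density hypothesis makes the maximum positive, hence W nonempty.\<close>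

lemma exists_min_degree_subset:
  fixes E :: "'a \<Rightarrow> 'a \<Rightarrow> bool" and m :: real
  assumes "finite V" and sym: "\<And>x y. E x y \<Longrightarrow> E y x"
    and dense: "2 * m * card V < card {(x, y). x \<in> V \<and> y \<in> V \<and> E x y}"
  obtains W where "W \<subseteq> V" "W \<noteq> {}" "\<And>x. x \<in> W \<Longrightarrow> m \<le> card {y \<in> W. E x y}"
proof -
  define A where "A = (\<lambda>W. {(x, y). x \<in> W \<and> y \<in> W \<and> E x y})"
  \<comment> \<open>Deleting a vertex of degree d from a maximiser W lowers the first term by at most 2d.\<close>
  define h where "h = (\<lambda>W. real (card (A W)) - 2 * m * card W)"
  have "Max (h ` Pow V) \<in> h ` Pow V"
    using assms(1) by (intro Max_in) auto
  then obtain W where W: "W \<subseteq> V" "h W = Max (h ` Pow V)" by auto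
  have h_le: "h U \<le> h W" if "U \<subseteq> V" for U
    unfolding W(2) using that assms(1) by (intro Max_ge) auto
  have finW: "finite W" using W(1) assms(1) by (rule finite_subset)
  have "h V > 0" using dense by (simp add: h_def A_def)
  moreover have "h {} = 0" by (simp add: h_def A_def)
  ultimately have "W \<noteq> {}" using h_le[of V] by auto
  moreover have "m \<le> card {y \<in> W. E x y}" if x: "x \<in> W" for x
  proof -
    let ?N = "{y \<in> W. E x y}"
    have finA: "finite (A (W - {x}))"
      by (rule finite_subset[of _ "W \<times> W"]) (auto simp: A_def finW)
    have "A W \<subseteq> A (W - {x}) \<union> ({x} \<times> ?N \<union> ?N \<times> {x})"
      by (auto simp: A_def sym)
    then have "card (A W) \<le> card (A (W - {x}) \<union> ({x} \<times> ?N \<union> ?N \<times> {x}))"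
      using finA finW by (intro card_mono) auto
    also have "\<dots> \<le> card (A (W - {x})) + (card ({x} \<times> ?N) + card (?N \<times> {x}))"
      by (meson add_left_mono card_Un_le order_trans)
    finally have "card (A W) \<le> card (A (W - {x})) + 2 * card ?N"
      by (simp add: card_cartesian_product)
    moreover have "h (W - {x}) \<le> h W" using W(1) by (intro h_le) auto
    moreover have "real (card W) = real (card (W - {x})) + 1"
      using card_Suc_Diff1[OF finW x] by linarith
    ultimately show ?thesis by (simp add: h_def algebra_simps)
  qed
  ultimately show ?thesis using that W(1) by blast
qed

text \<open>Two bounds on \<open>H (Suc l)\<close> are compared: at least 1 by the fixed vector, and
  small by the absence of rainbow cycles.\<close>

lemma min_degree_bound_of_no_rainbow_cycle:
  fixes E :: "'a \<Rightarrow> 'a \<Rightarrow> bool" and c :: "'a \<Rightarrow> 'b" and m :: real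
  assumes "finite W" "W \<noteq> {}" and sym: "\<And>x y. E x y \<Longrightarrow> E y x"
    and m: "0 < m" "\<And>x. x \<in> W \<Longrightarrow> m \<le> card {y \<in> W. E x y}"
    and uniq: "\<And>x y z. E x y \<Longrightarrow> E x z \<Longrightarrow> c y = c z \<Longrightarrow> y = z"
    and no_cycle: "\<And>xs. xs \<in> nlists W (2 * Suc l) \<Longrightarrow> distinct (map c xs) \<Longrightarrow>
      \<exists>i<2 * Suc l. \<not> E (xs ! i) (xs ! ((i + 1) mod (2 * Suc l)))"
  shows "m ^ Suc l \<le> (real (2 * Suc l) ^ 4) ^ Suc l * card W"
proof -
  define d where "d = (\<lambda>x. real (card {y \<in> W. E x y}))"
  \<comment> \<open>This normalisation fixes the vector \<open>sqrt (d x)\<close>, and column w has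
    \<open>d w\<close> nonzero entries with squares at most \<open>1 / (m * d w)\<close>.\<close>
  define K where "K = (\<lambda>x y. if x \<in> W \<and> y \<in> W \<and> E x y then 1 / sqrt (d x * d y) else 0)"
  have d: "m \<le> d x" "0 < d x" if "x \<in> W" for x
    using m(1) m(2)[OF that] by (auto simp: d_def)
  interpret conflict_kernel W K c "1 / m"
  proof
    show "K x y = K y x" for x y by (auto simp: K_def sym mult.commute)
    show "0 \<le> K x y" for x y by (simp add: K_def d_def)
    show "y = z" if "K x y \<noteq> 0" "K x z \<noteq> 0" "c y = c z" for x y z
      using that uniq by (auto simp: K_def split: if_splits)
    show "(\<Sum>a\<in>W. (K a w)\<^sup>2) \<le> 1 / m" if w: "w \<in> W" for w
    proof -
      have "(\<Sum>a\<in>W. (K a w)\<^sup>2) = (\<Sum>a\<in>{a \<in> W. E w a}. (K a w)\<^sup>2)"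
        using assms(1) by (intro sum.mono_neutral_right) (auto simp: K_def sym)
      also have "\<dots> \<le> (\<Sum>a\<in>{a \<in> W. E w a}. 1 / (m * d w))"
      proof (rule sum_mono)
        fix a assume "a \<in> {a \<in> W. E w a}"
        then have a: "a \<in> W" "(K a w)\<^sup>2 = 1 / (d a * d w)"
          using w sym[of w a] d(2)[of w] d(2)[of a] by (auto simp: K_def power_divide)
        have "m * d w \<le> d a * d w"
          using d(1)[OF a(1)] d(2)[OF w] by (intro mult_right_mono) simp_all
        then show "(K a w)\<^sup>2 \<le> 1 / (m * d w)"
          unfolding a(2) using d(2)[OF w] m(1) by (intro divide_left_mono) (simp_all add: d(2)[OF a(1)])
      qed
      also have "\<dots> = 1 / m"
        using d(2)[OF w] by (simp add: d_def)
      finally show ?thesis .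
    qed
  qed (use assms(1) in auto)
  have eigen: "(\<Sum>y\<in>W. K x y * sqrt (d y)) = sqrt (d x)" if x: "x \<in> W" for x
  proof -
    have "(\<Sum>y\<in>W. K x y * sqrt (d y)) = (\<Sum>y\<in>{y \<in> W. E x y}. K x y * sqrt (d y))"
      using assms(1) by (intro sum.mono_neutral_right) (auto simp: K_def)
    also have "\<dots> = (\<Sum>y\<in>{y \<in> W. E x y}. 1 / sqrt (d x))"
      using d x by (intro sum.cong) (auto simp: K_def real_sqrt_mult less_imp_neq[symmetric])
    also have "\<dots> = d x / sqrt (d x)"
      by (simp add: d_def)
    also have "\<dots> = sqrt (d x)"
      using d(2)[OF x] by (simp add: real_div_sqrt)
    finally show ?thesis .
  qed
  have "0 < (\<Sum>x\<in>W. (sqrt (d x))\<^sup>2)"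
    using assms(1,2) d(2) by (intro sum_pos) (simp_all add: order_less_imp_not_eq2)
  then have "1 \<le> H (Suc l)"
    using H_ge_1[of "\<lambda>x. sqrt (d x)"] eigen by blast
  also have "H (Suc l) \<le> (real (2 * Suc l) ^ 4 * (1 / m)) ^ Suc l * card W"
  proof (rule H_bound_of_no_rainbow_cycle)
    fix xs assume xs: "xs \<in> nlists W (2 * Suc l)" "distinct (map c xs)"
    then obtain i where "i < length xs" "\<not> E (xs ! i) (xs ! ((i + 1) mod length xs))"
      using no_cycle by force
    then have "K (xs ! i) (xs ! ((i + 1) mod length xs)) = 0"
      by (simp add: K_def)
    then show "cycle_weight K xs = 0"
      using cycle_weight_nonzero_step \<open>i < length xs\<close> by blast
  qed (use m(1) in simp)
  finally have "1 \<le> (real (2 * Suc l) ^ 4) ^ Suc l * card W / m ^ Suc l"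
    by (simp add: power_mult_distrib power_divide del: power_Suc)
  then show ?thesis
    using m(1) by (simp add: pos_le_divide_eq del: power_Suc)
qed

section \<open>Local collections\<close>

text \<open>Some vertex \<open>w j\<close> sees the whole cycle rainbow, in particular its two
  incident edges in different colours; i is the position before j.\<close>

lemma local_collection_cycle_graphD:
  fixes w :: "nat \<Rightarrow> nat"
  assumes "local_collection n (cycle_graph M) f" "3 \<le> M"
    and "inj_on w {..<M}" "w ` {..<M} \<subseteq> {..<n}"
  shows "\<exists>i<M. f (w ((i + 1) mod M)) {w i, w ((i + 1) mod M)} \<noteq>
    f (w ((i + 1) mod M)) {w ((i + 1) mod M), w ((i + 2) mod M)}"
proof -
  define e where "e = (\<lambda>i. {w i, w ((i + 1) mod M)})"
  define T where "T = (w ` {..<M}, e ` {..<M})"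
  have w_eq: "w i = w j \<longleftrightarrow> i = j" if "i < M" "j < M" for i j
    using assms(3) that by (auto simp: inj_on_def)
  \<comment> \<open>Here \<open>3 \<le> M\<close> enters: neither one nor two steps round the cycle
    return to i, so the two edges at a vertex are distinct.\<close>
  have next_neq: "i \<noteq> (i + 1) mod M" "i \<noteq> (i + 2) mod M" if "i < M" for i
    using that assms(2) by (auto simp: mod_if split: if_splits)
  have e: "e i \<subseteq> w ` {..<M} \<and> card (e i) = 2" if "i < M" for i
    using that next_neq[OF that] by (auto simp: e_def w_eq card_insert_if)
  have "simple_graph T"
    using e by (auto simp: simple_graph_def T_def)
  then have sub: "subgraph T (complete_graph n)"
    using e assms(4) by (auto simp: subgraph_def complete_graph_def T_def)
  have "graph_iso T (cycle_graph M)"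
    unfolding graph_iso_def
  proof (intro exI conjI)
    let ?\<phi> = "inv_into {..<M} w"
    show "bij_betw ?\<phi> (verts T) (verts (cycle_graph M))"
      using bij_betw_inv_into[of w "{..<M}" "w ` {..<M}"] assms(3)
      by (simp add: T_def cycle_graph_def bij_betw_def)
    have "?\<phi> ` e i = {i, (i + 1) mod M}" if "i < M" for i
      using that assms(3) by (simp add: e_def)
    then have "(\<lambda>e. ?\<phi> ` e) ` e ` {..<M} = (\<lambda>i. {i, (i + 1) mod M}) ` {..<M}"
      unfolding image_image by (intro image_cong) auto
    then show "(\<lambda>e. ?\<phi> ` e) ` edges T = edges (cycle_graph M)"
      by (auto simp: T_def cycle_graph_def)
  qed
  then obtain j where j: "j < M" "inj_on (f (w j)) (e ` {..<M})"
    using assms(1) sub by (auto simp: local_collection_def T_def)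
  \<comment> \<open>The cyclic predecessor of j; adding \<open>M - 1\<close> avoids subtraction at j
    = 0.\<close>
  define i where "i = (j + (M - 1)) mod M"
  have i: "i < M" "(i + 1) mod M = j"
    using j(1) assms(2) by (auto simp: i_def mod_simps)
  moreover have "((i + 1) mod M + 1) mod M = (i + 2) mod M"
    by (simp add: mod_simps)
  ultimately have i2: "(i + 2) mod M = (j + 1) mod M" by simp
  have "e i \<noteq> e j"
    using i i2 j(1) next_neq[OF i(1)] next_neq[OF j(1)] by (auto simp: e_def w_eq doubleton_eq_iff)
  then have "f (w j) (e i) \<noteq> f (w j) (e j)"
    using inj_onD[OF j(2)] i(1) j(1) by blast
  then show ?thesis
    using i i2 by (auto simp: e_def intro!: exI[of _ i])
qed

text \<open>A copy of the cycle is completed to a clique on its r vertices; a colouring injective on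
  the edges of the clique is injective on those of the cycle.\<close>

lemma local_collection_complete_imp_cycle:
  assumes "local_collection n (complete_graph r) f"
  shows "local_collection n (cycle_graph r) f"
  unfolding local_collection_def
proof (intro allI impI, elim conjE)
  fix T assume T: "subgraph T (complete_graph n)" "graph_iso T (cycle_graph r)"
  define S where "S = (verts T, {e. e \<subseteq> verts T \<and> card e = 2})"
  obtain \<phi> where \<phi>: "bij_betw \<phi> (verts T) {..<r}"
    using T(2) by (auto simp: graph_iso_def cycle_graph_def)
  have T_edges: "edges T \<subseteq> edges S"
    using T(1) by (auto simp: subgraph_def simple_graph_def S_def)
  have "subgraph S (complete_graph n)"
    using T(1) by (auto simp: subgraph_def simple_graph_def S_def complete_graph_def)
  moreover have "graph_iso S (complete_graph r)"
    unfolding graph_iso_def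
  proof (intro exI conjI)
    show "bij_betw \<phi> (verts S) (verts (complete_graph r))"
      using \<phi> by (simp add: S_def complete_graph_def)
    have inj: "inj_on \<phi> (verts T)" and im: "\<phi> ` verts T = {..<r}"
      using \<phi> by (auto simp: bij_betw_def)
    show "(\<lambda>e. \<phi> ` e) ` edges S = edges (complete_graph r)"
    proof (intro equalityI subsetI)
      fix e assume "e \<in> (\<lambda>e. \<phi> ` e) ` edges S"
      then show "e \<in> edges (complete_graph r)"
        using im inj by (auto simp: S_def complete_graph_def card_image inj_on_subset)
    next
      fix e assume "e \<in> edges (complete_graph r)"
      then have "e \<subseteq> \<phi> ` verts T" "card e = 2"
        using im by (auto simp: complete_graph_def)
      then obtain d where "d \<subseteq> verts T" "e = \<phi> ` d"
        by (auto simp: subset_image_iff)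
      then show "e \<in> (\<lambda>e. \<phi> ` e) ` edges S"
        using inj \<open>card e = 2\<close> by (auto simp: S_def card_image inj_on_subset)
    qed
  qed
  ultimately obtain u where "u \<in> verts S" "inj_on (f u) (edges S)"
    using assms[unfolded local_collection_def, rule_format, of S] by auto
  then show "\<exists>u\<in>verts T. inj_on (f u) (edges T)"
    using T_edges by (auto simp: S_def intro: inj_on_subset)
qed

text \<open>The degree bound is applied to the split graph. Half the cycle length is l + 1 here;
  cancelling one n and collecting the factors k leaves the exponents l and l + 2.\<close>

lemma local_cycle_colours_bound:
  assumes loc: "local_collection n (cycle_graph (2 * Suc l)) f" and l: "0 < l" and n: "2 \<le> n"
    and k: "\<And>v. v < n \<Longrightarrow> card (f v ` edges (complete_graph n)) \<le> k"
  shows "0 < k" "real n ^ l \<le> (8 * real (2 * Suc l) ^ 4) ^ Suc l * real k ^ Suc (Suc l)"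
proof -
  let ?E = "edges (complete_graph n)"
  have finE: "finite ?E"
    by (rule finite_subset[of _ "Pow {..<n}"]) (auto simp: complete_graph_def)
  have pair: "{v, u} \<in> ?E" if "v < n" "u < n" "v \<noteq> u" for v u
    using that by (auto simp: complete_graph_def)
  have "f 0 ` ?E \<noteq> {}" using pair[of 0 1] n by auto
  then have "0 < card (f 0 ` ?E)" using finE by (simp add: card_gt_0_iff)
  then show k0: "0 < k" using k[of 0] n by auto
  \<comment> \<open>Only colours that \<open>f v\<close> uses occur, so each v has at most k
    copies.\<close>
  define V where "V = (SIGMA v:{..<n}. f v ` ?E)"
  define E where "E = (\<lambda>p q. fst p < n \<and> fst q < n \<and> fst p \<noteq> fst q \<and>
    snd p = f (fst p) {fst p, fst q} \<and> snd q = f (fst q) {fst p, fst q})"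
  \<comment> \<open>There are at least n(n - 1) ordered edges on at most nk vertices. The constant 4
    makes \<open>2 * m * card V\<close> at most half of the former, which gives strict
    inequality.\<close>
  define m where "m = (real n - 1) / (4 * k)"
  have E_sym: "E q p" if "E p q" for p q
    using that by (auto simp: E_def insert_commute)
  have finV: "finite V" using finE by (simp add: V_def)
  have "card V = (\<Sum>v<n. card (f v ` ?E))"
    unfolding V_def using finE by (intro card_SigmaI) auto
  also have "\<dots> \<le> (\<Sum>v<n. k)"
    using k by (intro sum_mono) auto
  finally have cardV: "card V \<le> n * k" by simp
  define h where "h = (\<lambda>(v, u). ((v, f v {v, u}), (u, f u {v, u})))"
  define D where "D = (SIGMA v:{..<n}. {..<n} - {v})"
  have "card D = (\<Sum>v<n. card ({..<n} - {v}))"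
    unfolding D_def by (intro card_SigmaI) auto
  also have "\<dots> = n * (n - 1)" by simp
  finally have "n * (n - 1) = card (h ` D)"
    by (subst card_image) (auto simp: inj_on_def h_def)
  also have "\<dots> \<le> card {(x, y). x \<in> V \<and> y \<in> V \<and> E x y}"
  proof (rule card_mono)
    show "finite {(x, y). x \<in> V \<and> y \<in> V \<and> E x y}"
      by (rule finite_subset[of _ "V \<times> V"]) (auto simp: finV)
    show "h ` D \<subseteq> {(x, y). x \<in> V \<and> y \<in> V \<and> E x y}"
      using pair by (auto simp: h_def D_def V_def E_def)
  qed
  finally have edges: "real n * (real n - 1) \<le> card {(x, y). x \<in> V \<and> y \<in> V \<and> E x y}"
  proof -
    assume "n * (n - 1) \<le> card {(x, y). x \<in> V \<and> y \<in> V \<and> E x y}"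
    then have "real (n * (n - 1)) \<le> card {(x, y). x \<in> V \<and> y \<in> V \<and> E x y}"
      by (rule of_nat_mono)
    then show ?thesis using n by (simp add: of_nat_diff)
  qed
  have m0: "0 < m" using k0 n by (simp add: m_def)
  have "2 * m * card V \<le> 2 * m * (real n * real k)"
    using cardV m0 by (intro mult_left_mono) (auto simp flip: of_nat_mult)
  also have "\<dots> = real n * (real n - 1) / 2"
    using k0 by (simp add: m_def)
  also have "\<dots> < real n * (real n - 1)"
    using n by simp
  also note edges
  finally have dense: "2 * m * card V < card {(x, y). x \<in> V \<and> y \<in> V \<and> E x y}" .
  obtain W where W: "W \<subseteq> V" "W \<noteq> {}" "\<And>x. x \<in> W \<Longrightarrow> m \<le> card {y \<in> W. E x y}"
    using exists_min_degree_subset[where E = E, OF finV E_sym dense] by metis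
  have "m ^ Suc l \<le> (real (2 * Suc l) ^ 4) ^ Suc l * card W"
  proof (rule min_degree_bound_of_no_rainbow_cycle[where c = fst])
    show "finite W" using W(1) finV by (rule finite_subset)
    show "y = z" if "E x y" "E x z" "fst y = fst z" for x y z
      using that by (auto simp: E_def prod_eq_iff)
    fix xs assume xs: "xs \<in> nlists W (2 * Suc l)" "distinct (map fst xs)"
    let ?M = "2 * Suc l"
    show "\<exists>i<?M. \<not> E (xs ! i) (xs ! ((i + 1) mod ?M))"
    proof (rule ccontr)
      assume "\<not> ?thesis"
      then have cyc: "E (xs ! i) (xs ! ((i + 1) mod ?M))" if "i < ?M" for i
        using that by blast
      define w where "w = (\<lambda>i. fst (xs ! i))"
      have "inj_on w {..<?M}"
        using xs by (auto simp: inj_on_def w_def distinct_conv_nth)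
      moreover have "w ` {..<?M} \<subseteq> {..<n}"
        using cyc by (auto simp: w_def E_def)
      ultimately obtain i where i: "i < ?M" "f (w ((i + 1) mod ?M)) {w i, w ((i + 1) mod ?M)} \<noteq>
          f (w ((i + 1) mod ?M)) {w ((i + 1) mod ?M), w ((i + 2) mod ?M)}"
        using local_collection_cycle_graphD[OF loc, of w] l by auto
      have "((i + 1) mod ?M + 1) mod ?M = (i + 2) mod ?M"
        by (simp add: mod_simps)
      \<comment> \<open>The edges into and out of position i + 1 both have the colour stored in the
        second coordinate of that split vertex.\<close>
      then show False
        using cyc[OF i(1)] cyc[of "(i + 1) mod ?M"] i(2) by (auto simp: E_def w_def)
    qed
  qed (use W E_sym m0 in auto)
  also have "card W \<le> n * k"
    using card_mono[OF finV W(1)] cardV by linarith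
  finally have "m ^ Suc l \<le> (real (2 * Suc l) ^ 4) ^ Suc l * (real n * real k)"
    by (simp add: mult_left_mono flip: of_nat_mult)
  \<comment> \<open>Since \<open>2 \<le> n\<close>, n - 1 is at least n / 2, so 4 becomes 8.\<close>
  moreover have "(real n / (8 * k)) ^ Suc l \<le> m ^ Suc l"
    using n k0 by (intro power_mono) (auto simp: m_def field_simps)
  ultimately have "(real n / (8 * k)) ^ Suc l \<le> (real (2 * Suc l) ^ 4) ^ Suc l * (real n * real k)"
    by linarith
  then have "real n ^ Suc l \<le> (real (2 * Suc l) ^ 4) ^ Suc l * (real n * real k) * (8 * k) ^ Suc l"
    using k0 by (simp add: power_divide pos_divide_le_eq del: power_Suc)
  also have "\<dots> = real n * ((8 * real (2 * Suc l) ^ 4) ^ Suc l * real k ^ Suc (Suc l))"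
    by (simp add: power_mult_distrib)
  finally show "real n ^ l \<le> (8 * real (2 * Suc l) ^ 4) ^ Suc l * real k ^ Suc (Suc l)"
    using n by simp
qed

text \<open>Leaving \<open>G\<close> general serves both families: for a cycle the first hypothesis
  is immediate, for a clique it is \<open>local_collection_complete_imp_cycle\<close>. The bound on
  the power l + 1 of \<open>g n G\<close> is turned into one on \<open>g n G\<close> by taking a
  root.\<close>

lemma g_bigomega:
  assumes "\<And>n f. local_collection n G f \<Longrightarrow> local_collection n (cycle_graph (2 * l)) f"
    and "verts G \<noteq> {}" and l: "2 \<le> l"
  shows "(\<lambda>n. real (g n G)) \<in> \<Omega>(\<lambda>n. real n powr (1 - 2 / (real l + 1)))"
proof -
  obtain j where j: "l = Suc j" "0 < j" using l by (cases l) auto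
  define C where "C = (8 * real (2 * l) ^ 4) ^ l"
  have C0: "0 < C" using l by (simp add: C_def)
  have bound: "real n powr (1 - 2 / (real l + 1)) \<le> C powr (1 / (real l + 1)) * real (g n G)"
    if n: "2 \<le> n" for n
  proof -
    obtain f where f: "local_collection n G f"
        "\<And>v. v < n \<Longrightarrow> card (f v ` edges (complete_graph n)) \<le> g n G"
      using g_attained[OF assms(2), of n] by (auto simp: complete_graph_def)
    have g: "0 < g n G" and *: "real n ^ j \<le> C * real (g n G) ^ Suc l"
      using local_cycle_colours_bound[of n j f "g n G"] assms(1)[OF f(1)] f(2) j n
      by (auto simp: C_def)
    \<comment> \<open>The exponent is (l - 1) / (l + 1), and j = l - 1.\<close>
    have "real n powr (1 - 2 / (real l + 1)) = (real n ^ j) powr (1 / (real l + 1))"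
      using n j by (simp add: powr_powr field_simps flip: powr_realpow)
    also have "\<dots> \<le> (C * real (g n G) ^ Suc l) powr (1 / (real l + 1))"
      using * by (intro powr_mono2) auto
    also have "\<dots> = C powr (1 / (real l + 1)) * (real (g n G) ^ Suc l) powr (1 / (real l + 1))"
      using C0 by (intro powr_mult)
    also have "(real (g n G) ^ Suc l) powr (1 / (real l + 1)) = real (g n G)"
      using g by (simp add: powr_powr add.commute flip: powr_realpow del: power_Suc)
    finally show ?thesis .
  qed
  show ?thesis
    unfolding bigomega_iff_bigo
  proof (rule bigoI)
    show "\<forall>\<^sub>F n in at_top. norm (real n powr (1 - 2 / (real l + 1))) \<le>
        C powr (1 / (real l + 1)) * norm (real (g n G))"
      using eventually_ge_at_top[of 2] by eventually_elim (use bound in simp)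
  qed
qed

theorem theorem1p8:
  "(\<forall>l::nat. l \<ge> 2 \<longrightarrow>
      (\<lambda>n. real (g n (cycle_graph (2 * l)))) \<in> \<Omega>(\<lambda>n. real n powr (1 - 2 / (real l + 1)))) \<and>
   (\<forall>r::nat. r \<ge> 4 \<and> even r \<longrightarrow>
      (\<lambda>n. real (g n (complete_graph r))) \<in> \<Omega>(\<lambda>n. real n powr (1 - 4 / (real r + 2))))"
proof (intro conjI allI impI, goal_cases)
  case (1 l)
  then show ?case
    by (intro g_bigomega) (auto simp: cycle_graph_def lessThan_empty_iff)
next
  case (2 r)
  then obtain l where r: "r = 2 * l" "2 \<le> l" by (auto elim!: evenE)
  have "4 / (real r + 2) = 2 / (real l + 1)"
    by (simp add: r field_simps)
  moreover have "(\<lambda>n. real (g n (complete_graph r))) \<in> \<Omega>(\<lambda>n. real n powr (1 - 2 / (real l + 1)))"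
    using r by (intro g_bigomega local_collection_complete_imp_cycle)
      (auto simp: complete_graph_def lessThan_empty_iff)
  ultimately show ?case by simp
qed

end
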